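(* Suppose that in the regression model $Y_j(t_i)=g(t_i)+\varepsilon_j(t_i)$ ($i=1,\dots,n$, $j=1,\dots,m$), with design $0\le t_1<\dots<t_n\le 1$, $n\ge 2$, the error process $\varepsilon$ is the Ornstein–Uhlenbeck process with autocovariance $R(s,t)=e^{-|t-s|}$. Then for any $x\in[0,1]$ the projection estimator satisfies $$\begin{aligned}\hat g^{pro}_n(x)={}&\sum_{i=2}^{n-1}\overline Y(t_i)\int_{t_{i-1}}^{t_{i+1}}e^{|s-t_i|}\varphi_{x,h}(s)\,ds+\overline Y(t_1)\int_0^{t_2}e^{s-t_1}\varphi_{x,h}(s)\,ds+\overline Y(t_n)\int_{t_{n-1}}^1e^{t_n-s}\varphi_{x,h}(s)\,ds\\&-\sum_{i=1}^{n-1}\frac{e^{t_{i+1}}\overline Y(t_{i+1})-e^{t_i}\overline Y(t_i)}{1-e^{-2(t_{i+1}-t_i)}}\int_{t_i}^{t_{i+1}}e^{-s}\varphi_{x,h}(s)\,ds\\&+\sum_{i=1}^{n-1}\frac{e^{-t_{i+1}}\overline Y(t_{i+1})-e^{-t_i}\overline Y(t_i)}{1-e^{-2(t_{i+1}-t_i)}}\int_{t_i}^{t_{i+1}}e^{s}\varphi_{x,h}(s)\,ds.\end{aligned}$$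
   Context: Model: $g:[0,1]\to\mathbb R$ is the regression function, and $\varepsilon_1,\dots,\varepsilon_m$ are i.i.d. copies of a centered second-order process $\varepsilon$ on $[0,1]$ with autocovariance $R(s,t)=\mathbb E(\varepsilon(s)\varepsilon(t))$. $\overline Y(t_i)=\frac1m\sum_{j=1}^mY_j(t_i)$. $K$ is a kernel of class $C^1$ with support $[-1,1]$, $\int_{-1}^1K(t)dt=1$, $\int_{-1}^1tK(t)dt=0$, $\int_{-1}^1t^2K(t)dt<\infty$; $h\in(0,1)$ is the bandwidth and $\varphi_{x,h}(s)=\frac1hK\big(\frac{x-s}{h}\big)$. Projection estimator: with $f_{x,h}(t)=\int_0^1R(s,t)\varphi_{x,h}(s)\,ds$, $R_{|T_n}=(R(t_i,t_j))_{1\le i,j\le n}$ (an invertible matrix), define the weights by the row vector $(m_{x,h}(t_1),\dots,m_{x,h}(t_n))=(f_{x,h}(t_1),\dots,f_{x,h}(t_n))R_{|T_n}^{-1}$ and $\hat g_n^{pro}(x)=\sum_{i=1}^nm_{x,h}(t_i)\overline Y(t_i)$. *)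

theory Defs
  imports
    "HOL-Probability.Probability"
    "Jordan_Normal_Form.Gauss_Jordan_Elimination"
begin

text \<open>A process is a family \<open>X :: real \<Rightarrow> 'w \<Rightarrow> real\<close>; only its members with time
  index in the given set \<open>I\<close> are constrained.\<close>

definition second_order_process ::
    "'w measure \<Rightarrow> real set \<Rightarrow> (real \<Rightarrow> 'w \<Rightarrow> real) \<Rightarrow> bool" where
  "second_order_process M I X \<longleftrightarrow>
     (\<forall>t\<in>I. X t \<in> borel_measurable M \<and> integrable M (\<lambda>\<omega>. (X t \<omega>)\<^sup>2))"

definition centered_process ::
    "'w measure \<Rightarrow> real set \<Rightarrow> (real \<Rightarrow> 'w \<Rightarrow> real) \<Rightarrow> bool" where
  "centered_process M I X \<longleftrightarrow> (\<forall>t\<in>I. (\<integral>\<omega>. X t \<omega> \<partial>M) = 0)"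

text \<open>No mean is subtracted: this is the autocovariance of a centered process.\<close>

definition autocov :: "'w measure \<Rightarrow> (real \<Rightarrow> 'w \<Rightarrow> real) \<Rightarrow> real \<Rightarrow> real \<Rightarrow> real" where
  "autocov M X s t = (\<integral>\<omega>. X s \<omega> * X t \<omega> \<partial>M)"

text \<open>Constants count as (degenerate) Gaussian variables, so that all linear combinations
  of the coordinates of a Gaussian vector are Gaussian.\<close>

definition gaussian_rv :: "'w measure \<Rightarrow> ('w \<Rightarrow> real) \<Rightarrow> bool" where
  "gaussian_rv M Z \<longleftrightarrow> Z \<in> borel_measurable M \<and>
     ((\<exists>\<mu> \<sigma>. \<sigma> > 0 \<and> distributed M lborel Z (normal_density \<mu> \<sigma>)) \<or>
      (\<exists>c. AE \<omega> in M. Z \<omega> = c))"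

definition gaussian_process ::
    "'w measure \<Rightarrow> real set \<Rightarrow> (real \<Rightarrow> 'w \<Rightarrow> real) \<Rightarrow> bool" where
  "gaussian_process M I X \<longleftrightarrow>
     (\<forall>J a. finite J \<and> J \<subseteq> I \<longrightarrow> gaussian_rv M (\<lambda>\<omega>. \<Sum>t\<in>J. a t * X t \<omega>))"

definition ornstein_uhlenbeck_process ::
    "'w measure \<Rightarrow> real set \<Rightarrow> (real \<Rightarrow> 'w \<Rightarrow> real) \<Rightarrow> bool" where
  "ornstein_uhlenbeck_process M I X \<longleftrightarrow>
     gaussian_process M I X \<and> second_order_process M I X \<and> centered_process M I X \<and>
     (\<forall>s\<in>I. \<forall>t\<in>I. autocov M X s t = exp (- \<bar>t - s\<bar>))"

text \<open>Sample paths are random elements of the product space over \<open>I\<close>, so independence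
  and equality in law are those of whole processes (all finite-dimensional distributions).\<close>

definition path_on :: "real set \<Rightarrow> (real \<Rightarrow> 'w \<Rightarrow> real) \<Rightarrow> 'w \<Rightarrow> real \<Rightarrow> real" where
  "path_on I X \<omega> = (\<lambda>t\<in>I. X t \<omega>)"

definition iid_copies ::
    "'w measure \<Rightarrow> real set \<Rightarrow> (real \<Rightarrow> 'w \<Rightarrow> real) \<Rightarrow> 'j set \<Rightarrow>
      ('j \<Rightarrow> real \<Rightarrow> 'w \<Rightarrow> real) \<Rightarrow> bool" where
  "iid_copies M I X J Z \<longleftrightarrow>
     prob_space.indep_vars M (\<lambda>_. Pi\<^sub>M I (\<lambda>_. borel)) (\<lambda>j. path_on I (Z j)) J \<and>
     (\<forall>j\<in>J. distr M (Pi\<^sub>M I (\<lambda>_. borel)) (path_on I (Z j)) =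
            distr M (Pi\<^sub>M I (\<lambda>_. borel)) (path_on I X))"

definition smoothing_kernel :: "(real \<Rightarrow> real) \<Rightarrow> bool" where
  "smoothing_kernel K \<longleftrightarrow>
     K C1_differentiable_on UNIV \<and> closure {u. K u \<noteq> 0} = {-1..1} \<and>
     integral {-1..1} K = 1 \<and> integral {-1..1} (\<lambda>u. u * K u) = 0 \<and>
     (\<lambda>u. u\<^sup>2 * K u) integrable_on {-1..1}"

definition phi :: "(real \<Rightarrow> real) \<Rightarrow> real \<Rightarrow> real \<Rightarrow> real \<Rightarrow> real" where
  "phi K x h s = (1 / h) * K ((x - s) / h)"

definition f_proj ::
    "(real \<Rightarrow> real \<Rightarrow> real) \<Rightarrow> (real \<Rightarrow> real) \<Rightarrow> real \<Rightarrow> real \<Rightarrow> real \<Rightarrow> real" where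
  "f_proj R K x h t = integral {0..1} (\<lambda>s. R s t * phi K x h s)"

text \<open>The design is \<open>t 1, \<dots>, t n\<close>, whereas matrix entries are indexed from 0.\<close>

definition cov_mat :: "(real \<Rightarrow> real \<Rightarrow> real) \<Rightarrow> nat \<Rightarrow> (nat \<Rightarrow> real) \<Rightarrow> real mat" where
  "cov_mat R n t = Matrix.mat n n (\<lambda>(i, j). R (t (Suc i)) (t (Suc j)))"

text \<open>\<open>the\<close> is only meaningful when the covariance matrix is invertible.\<close>

definition proj_weights ::
    "(real \<Rightarrow> real \<Rightarrow> real) \<Rightarrow> (real \<Rightarrow> real) \<Rightarrow> real \<Rightarrow> real \<Rightarrow> nat \<Rightarrow> (nat \<Rightarrow> real) \<Rightarrow> real mat" where
  "proj_weights R K x h n t =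
     Matrix.mat 1 n (\<lambda>(_, j). f_proj R K x h (t (Suc j))) * the (mat_inverse (cov_mat R n t))"

definition Ybar :: "nat \<Rightarrow> (nat \<Rightarrow> real \<Rightarrow> 'w \<Rightarrow> real) \<Rightarrow> real \<Rightarrow> 'w \<Rightarrow> real" where
  "Ybar m Y s \<omega> = (1 / real m) * (\<Sum>j=1..m. Y j s \<omega>)"

definition g_pro ::
    "(real \<Rightarrow> real \<Rightarrow> real) \<Rightarrow> (real \<Rightarrow> real) \<Rightarrow> real \<Rightarrow> nat \<Rightarrow> (nat \<Rightarrow> real) \<Rightarrow>
      nat \<Rightarrow> (nat \<Rightarrow> real \<Rightarrow> 'w \<Rightarrow> real) \<Rightarrow> real \<Rightarrow> 'w \<Rightarrow> real" where
  "g_pro R K h n t m Y x \<omega> =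
     (\<Sum>i=1..n. proj_weights R K x h n t $$ (0, i - 1) * Ybar m Y (t i) \<omega>)"

end

theory Submission
  imports Defs "Jordan_Normal_Form.Determinant"
begin

text \<open>Put \<open>c = R\<^sup>-\<^sup>1 Y\<close> and \<open>F s = (\<Sum>j. c j * exp (- \<bar>t j - s\<bar>))\<close>. Then \<open>F\<close> interpolates the data
  at the design points and the estimator is the integral of \<open>F * \<phi>\<close> over \<open>[0, 1]\<close>. Between two
  neighbouring design points \<open>F\<close> is a combination of \<open>exp s\<close> and \<open>exp (- s)\<close>, hence determined
  by its two endpoint values; to the left and to the right of the design it is a multiple of
  \<open>exp s\<close> and of \<open>exp (- s)\<close>, respectively. Splitting the integral at the design points gives the
  formula. Invertibility of \<open>R\<close> follows by eliminating the last unknown from the last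
  two equations of \<open>R v = 0\<close>.\<close>

section \<open>Invertibility of the exponential covariance matrix\<close>

lemma strict_mono_on_atLeastAtMost_SucD:
  fixes t :: "nat \<Rightarrow> 'a::order"
  assumes "strict_mono_on {1..Suc n} t"
  shows "strict_mono_on {1..n} t"
  using assms by (rule monotone_on_subset) auto

text \<open>At every point to the right of \<open>t n\<close> the first \<open>n\<close> unknowns
  enter only through one number \<open>S\<close>. Rows \<open>n\<close> and \<open>Suc n\<close> are
  thus two linear equations in \<open>S\<close> and \<open>v (Suc n)\<close>, and these are
  independent since \<open>t n < t (Suc n)\<close>. Once \<open>v (Suc n) = 0\<close>, the first
  \<open>n\<close> rows are the same problem of size \<open>n\<close>.\<close>

lemma exp_kernel_injective:
  fixes t v :: "nat \<Rightarrow> real"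
  assumes "strict_mono_on {1..n} t"
    and "\<And>i. i \<in> {1..n} \<Longrightarrow> (\<Sum>j=1..n. exp (- \<bar>t j - t i\<bar>) * v j) = 0"
    and "j \<in> {1..n}"
  shows "v j = 0"
  using assms
proof (induction n arbitrary: j)
  case 0
  then show ?case by simp
next
  case (Suc n)
  have last: "v (Suc n) = 0"
  proof (cases "n = 0")
    case True
    then show ?thesis using Suc.prems(2)[of 1] by simp
  next
    case False
    have lt: "t n < t (Suc n)"
      using False strict_mono_onD[OF Suc.prems(1), of n "Suc n"] by simp
    have le: "t j \<le> t n" if "j \<in> {1..n}" for j
      using that strict_mono_on_leD[OF Suc.prems(1), of j n] by simp
    define S where "S = (\<Sum>j=1..n. exp (t j) * v j)"
    \<comment> \<open>All \<open>t j\<close> lie to the left of \<open>u\<close>, so each absolute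
      value is \<open>u - t j\<close> and \<open>exp (- u)\<close> factors out. The fact is applied
      at \<open>u = t n\<close> and \<open>u = t (Suc n)\<close>.\<close>
    have *: "(\<Sum>j=1..n. exp (- \<bar>t j - u\<bar>) * v j) = exp (- u) * S" if "t n \<le> u" for u
      unfolding S_def sum_distrib_left
    proof (rule sum.cong)
      fix j assume "j \<in> {1..n}"
      then have "t j \<le> u" using le that by force
      then show "exp (- \<bar>t j - u\<bar>) * v j = exp (- u) * (exp (t j) * v j)"
        by (simp add: exp_diff exp_minus field_simps)
    qed simp
    have "exp (- t (Suc n)) * S + v (Suc n) = 0"
      using Suc.prems(2)[of "Suc n"] * [of "t (Suc n)"] lt by simp
    moreover have "exp (- t n) * S + exp (- (t (Suc n) - t n)) * v (Suc n) = 0"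
      using Suc.prems(2)[of n] * [of "t n"] lt False by simp
    \<comment> \<open>This is the coefficient of \<open>v (Suc n)\<close> after row \<open>n\<close>
      is multiplied by \<open>exp (t n)\<close>; row \<open>Suc n\<close> multiplied by
      \<open>exp (t (Suc n))\<close> has the larger coefficient \<open>exp (t (Suc n))\<close>, so
      subtraction eliminates \<open>S\<close>.\<close>
    moreover have "exp (t n - (t (Suc n) - t n)) = exp (t n) * (exp (t n) / exp (t (Suc n)))"
      by (simp only: exp_diff) simp
    ultimately have "S + exp (t (Suc n)) * v (Suc n) = 0"
      and "S + exp (t n - (t (Suc n) - t n)) * v (Suc n) = 0"
      by (simp_all only: exp_diff exp_minus) (simp_all add: field_simps)
    then have "(exp (t (Suc n)) - exp (t n - (t (Suc n) - t n))) * v (Suc n) = 0"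
      by (simp only: left_diff_distrib)
    then show ?thesis using lt by simp
  qed
  show ?case
  proof (cases "j = Suc n")
    case True
    then show ?thesis using last by simp
  next
    case False
    have "(\<Sum>j=1..n. exp (- \<bar>t j - t i\<bar>) * v j) = 0" if "i \<in> {1..n}" for i
      using Suc.prems(2)[of i] that last by simp
    then show ?thesis
      using Suc.IH[OF strict_mono_on_atLeastAtMost_SucD[OF Suc.prems(1)]] Suc.prems(3) False
      by simp
  qed
qed

text \<open>A vanishing determinant would give a nonzero kernel vector, whose entries, shifted to
  indices from 1, contradict \<open>exp_kernel_injective\<close>.\<close>

lemma det_cov_mat_exp_nonzero:
  assumes "strict_mono_on {1..n} t"
  shows "Determinant.det (cov_mat (\<lambda>s u. exp (- \<bar>u - s\<bar>)) n t) \<noteq> 0"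
proof
  let ?A = "cov_mat (\<lambda>s u. exp (- \<bar>u - s\<bar>)) n t"
  have A: "?A \<in> carrier_mat n n" by (simp add: cov_mat_def)
  assume "Determinant.det ?A = 0"
  then obtain w where w: "w \<in> carrier_vec n" "w \<noteq> 0\<^sub>v n" "?A *\<^sub>v w = 0\<^sub>v n"
    using det_0_iff_vec_prod_zero_field[OF A] by auto
  have "(\<Sum>j=1..n. exp (- \<bar>t j - t i\<bar>) * vec_index w (j - 1)) = 0" if "i \<in> {1..n}" for i
  proof -
    have "0 = vec_index (?A *\<^sub>v w) (i - 1)" using w(3) that by auto
    also have "\<dots> = (\<Sum>j<n. exp (- \<bar>t (Suc j) - t i\<bar>) * vec_index w j)"
      using that w(1)
      by (auto simp: cov_mat_def scalar_prod_def atLeast0LessThan)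
    finally show ?thesis
      by (simp add: sum.atLeast1_atMost_eq)
  qed
  then have "vec_index w (j - 1) = 0" if "j \<in> {1..n}" for j
    using exp_kernel_injective[OF assms, of "\<lambda>j. vec_index w (j - 1)"] that by simp
  then have "vec_index w j = 0" if "j < n" for j
    using that by (metis One_nat_def Suc_leI atLeastAtMost_iff diff_Suc_1 le_add1 plus_1_eq_Suc)
  then have "w = 0\<^sub>v n" using w(1) by auto
  with w(2) show False by simp
qed

section \<open>The estimator in terms of the solution of the covariance system\<close>

lemma mat_inverse_eq_Some:
  fixes A :: "'a::field mat"
  assumes A: "A \<in> carrier_mat n n" and "Determinant.det A \<noteq> 0"
  obtains B where "mat_inverse A = Some B" "B \<in> carrier_mat n n" "A * B = 1\<^sub>m n"
proof (cases "mat_inverse A")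
  case None
  \<comment> \<open>The parameter \<open>b\<close> is the free extension part of the matrix ring
    record; fixing it to \<open>()\<close> makes both facts speak of the same group of
    units.\<close>
  then show ?thesis
    using mat_inverse(1)[OF A, where b = "()"] det_non_zero_imp_unit[OF A assms(2), where b = "()"]
    by blast
next
  case (Some B)
  then show ?thesis using mat_inverse(2)[OF A] that by blast
qed

text \<open>The product of the row of \<open>f_proj\<close> values, the inverse matrix and the data
  vector is bracketed the other way: the inverse is applied to the data first. The resulting
  coefficients solve the covariance system, because the inverse is a right inverse.\<close>

lemma g_pro_eq_sum_coeffs:
  assumes "Determinant.det (cov_mat R n t) \<noteq> 0"
  obtains c where
    "\<And>k. k \<in> {1..n} \<Longrightarrow> (\<Sum>j=1..n. c j * R (t k) (t j)) = Ybar m Y (t k) \<omega>"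
    "g_pro R K h n t m Y x \<omega> = (\<Sum>j=1..n. c j * f_proj R K x h (t j))"
proof -
  have A: "cov_mat R n t \<in> carrier_mat n n" by (simp add: cov_mat_def)
  obtain B where B: "mat_inverse (cov_mat R n t) = Some B" "B \<in> carrier_mat n n"
    "cov_mat R n t * B = 1\<^sub>m n"
    using mat_inverse_eq_Some[OF A assms] by blast
  define y where "y i = Ybar m Y (t (Suc i)) \<omega>" for i
  \<comment> \<open>The coefficients count from 1 like the design, the rows of \<open>B\<close> from
    0.\<close>
  define c where "c j = (\<Sum>i<n. B $$ (j - 1, i) * y i)" for j
  have c_Suc: "c (Suc j) = (\<Sum>i<n. B $$ (j, i) * y i)" for j by (simp add: c_def)
  have AB: "(\<Sum>j<n. R (t (Suc k)) (t (Suc j)) * B $$ (j, i)) = (if k = i then 1 else 0)"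
    if "k < n" "i < n" for k i
  proof -
    have "(cov_mat R n t * B) $$ (k, i) =
        (\<Sum>j<n. R (t (Suc k)) (t (Suc j)) * B $$ (j, i))"
      using that B(2) by (simp add: cov_mat_def scalar_prod_def atLeast0LessThan)
    then show ?thesis using B(3) that by simp
  qed
  have W: "proj_weights R K x h n t $$ (0, i) = (\<Sum>j<n. f_proj R K x h (t (Suc j)) * B $$ (j, i))"
    if "i < n" for i
    using that B by (simp add: proj_weights_def scalar_prod_def atLeast0LessThan)
  show thesis
  proof (rule that)
    fix k assume k: "k \<in> {1..n}"
    then obtain k' where k': "k = Suc k'" "k' < n" by (cases k) auto
    have "(\<Sum>j=1..n. c j * R (t k) (t j)) =
        (\<Sum>j<n. \<Sum>i<n. R (t (Suc k')) (t (Suc j)) * B $$ (j, i) * y i)"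
      unfolding One_nat_def sum.atLeast1_atMost_eq k' c_Suc by (simp add: sum_distrib_left mult_ac)
    also have "\<dots> = (\<Sum>i<n. (\<Sum>j<n. R (t (Suc k')) (t (Suc j)) * B $$ (j, i)) * y i)"
      by (subst sum.swap) (simp add: sum_distrib_right)
    also have "\<dots> = (\<Sum>i<n. if k' = i then y i else 0)"
      using k' by (intro sum.cong) (auto simp: AB)
    also have "\<dots> = y k'" using k' by simp
    finally show "(\<Sum>j=1..n. c j * R (t k) (t j)) = Ybar m Y (t k) \<omega>"
      using k' by (simp add: y_def)
  next
    have "g_pro R K h n t m Y x \<omega> =
        (\<Sum>i<n. (\<Sum>j<n. f_proj R K x h (t (Suc j)) * B $$ (j, i)) * y i)"
      unfolding g_pro_def One_nat_def sum.atLeast1_atMost_eq by (simp add: W y_def)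
    also have "\<dots> = (\<Sum>j<n. f_proj R K x h (t (Suc j)) * c (Suc j))"
      unfolding c_Suc sum_distrib_left sum_distrib_right
      by (subst sum.swap) (simp add: mult_ac)
    finally show "g_pro R K h n t m Y x \<omega> = (\<Sum>j=1..n. c j * f_proj R K x h (t j))"
      unfolding One_nat_def sum.atLeast1_atMost_eq by (simp add: mult_ac)
  qed
qed

section \<open>Interpolation between neighbouring design points\<close>

text \<open>For \<open>u\<close> outside the open interval, the left side is on
  \<open>[a, b]\<close> a multiple of \<open>exp s\<close> or of \<open>exp (- s)\<close>. The right
  side is the combination of these two functions with the same values at \<open>a\<close> and
  \<open>b\<close>, arranged as in the target formula. It is linear in the endpoint values, so it
  carries over to sums over \<open>u\<close>.\<close>

lemma exp_kernel_interpolation: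
  fixes a b s u :: real
  assumes "a < b" "a \<le> s" "s \<le> b" "u \<le> a \<or> b \<le> u"
  defines "D \<equiv> 1 - exp (- 2 * (b - a))"
  shows "exp (- \<bar>u - s\<bar>) =
      exp (s - a) * exp (- \<bar>u - a\<bar>) + exp (b - s) * exp (- \<bar>u - b\<bar>)
      - (exp b * exp (- \<bar>u - b\<bar>) - exp a * exp (- \<bar>u - a\<bar>)) / D * exp (- s)
      + (exp (- b) * exp (- \<bar>u - b\<bar>) - exp (- a) * exp (- \<bar>u - a\<bar>)) / D * exp s"
proof -
  have D: "D \<noteq> 0" using \<open>a < b\<close> by (simp add: D_def)
  have pos: "exp a \<noteq> 0" "exp b \<noteq> 0" "exp s \<noteq> 0" "exp u \<noteq> 0" by simp_all
  \<comment> \<open>Writing \<open>D\<close> through \<open>exp a\<close> and \<open>exp b\<close>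
    turns the claim into a rational identity in exponentials.\<close>
  have D_eq: "D * (exp b)\<^sup>2 = (exp b)\<^sup>2 - (exp a)\<^sup>2"
    by (simp add: D_def exp_diff exp_minus field_simps flip: exp_double)
  have D': "D = ((exp b)\<^sup>2 - (exp a)\<^sup>2) / (exp b)\<^sup>2"
    using D_eq by (simp add: field_simps)
  have ne: "(exp b)\<^sup>2 - (exp a)\<^sup>2 \<noteq> 0" using D D' by auto
  \<comment> \<open>Since \<open>u\<close> is not strictly between \<open>a\<close> and
    \<open>b\<close>, all three absolute values open with the same sign.\<close>
  have abs: "(\<bar>u - s\<bar> = s - u \<and> \<bar>u - a\<bar> = a - u \<and> \<bar>u - b\<bar> = b - u) \<or>
      (\<bar>u - s\<bar> = u - s \<and> \<bar>u - a\<bar> = u - a \<and> \<bar>u - b\<bar> = u - b)"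
    using assms(1-4) by auto
  then show ?thesis
  proof (elim disjE conjE)
    assume *: "\<bar>u - s\<bar> = s - u" "\<bar>u - a\<bar> = a - u" "\<bar>u - b\<bar> = b - u"
    show ?thesis
      unfolding * D' using pos ne
      by (simp add: exp_diff exp_minus divide_simps) (simp add: algebra_simps power2_eq_square)
  next
    assume *: "\<bar>u - s\<bar> = u - s" "\<bar>u - a\<bar> = u - a" "\<bar>u - b\<bar> = u - b"
    show ?thesis
      unfolding * D' using pos ne
      by (simp add: exp_diff exp_minus divide_simps) (simp add: algebra_simps power2_eq_square)
  qed
qed

lemma integral_consecutive:
  fixes f :: "real \<Rightarrow> real" and t :: "nat \<Rightarrow> real"
  assumes "continuous_on UNIV f" "strict_mono_on {1..n} t" "1 \<le> n"
  shows "integral {t 1..t n} f = (\<Sum>i=1..n-1. integral {t i..t (i+1)} f)"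
  using assms(3,2)
proof (induction n rule: dec_induct)
  case base
  then show ?case by simp
next
  case (step n)
  have "t 1 \<le> t n" "t n \<le> t (Suc n)"
    using step.hyps strict_mono_on_leD[OF step.prems, of 1 n]
      strict_mono_on_leD[OF step.prems, of n "Suc n"] by simp_all
  then have "integral {t 1..t (Suc n)} f = integral {t 1..t n} f + integral {t n..t (Suc n)} f"
    using assms(1)
    by (intro Henstock_Kurzweil_Integration.integral_combine[symmetric] integrable_continuous_real)
      (auto intro: continuous_on_subset)
  moreover have "{1..Suc n - 1} = insert n {1..n - 1}" "n \<notin> {1..n - 1}"
    using step by auto
  ultimately show ?case
    using step.IH[OF strict_mono_on_atLeastAtMost_SucD[OF step.prems]] by simp
qed

text \<open>The law of the errors fixes the autocovariance only for times in \<open>[0, 1]\<close>;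
  this allows replacing it by the explicit exponential kernel, as the weights evaluate it only
  there.\<close>

lemma proj_weights_cong:
  assumes "\<And>s u. s \<in> {0..1} \<Longrightarrow> u \<in> {0..1} \<Longrightarrow> R s u = R' s u"
    and "\<And>i. i \<in> {1..n} \<Longrightarrow> t i \<in> {0..1}"
  shows "proj_weights R K x h n t = proj_weights R' K x h n t"
proof -
  have "f_proj R K x h (t (Suc j)) = f_proj R' K x h (t (Suc j))" if "j < n" for j
    unfolding f_proj_def using that assms
    by (intro Henstock_Kurzweil_Integration.integral_cong) auto
  then have "Matrix.mat 1 n (\<lambda>(_, j). f_proj R K x h (t (Suc j))) =
      Matrix.mat 1 n (\<lambda>(_, j). f_proj R' K x h (t (Suc j)))"
    by (intro eq_matI) auto
  moreover have "cov_mat R n t = cov_mat R' n t"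
    unfolding cov_mat_def using assms by (intro eq_matI) auto
  ultimately show ?thesis by (simp add: proj_weights_def)
qed

lemma continuous_on_phi:
  assumes "smoothing_kernel K" "h \<noteq> 0"
  shows "continuous_on A (phi K x h)"
proof -
  have "continuous_on UNIV K"
    using assms(1) C1_differentiable_imp_continuous_on by (auto simp: smoothing_kernel_def)
  then have "continuous_on A (\<lambda>s. K ((x - s) / h))"
    by (rule continuous_on_compose2) (use assms(2) in \<open>auto intro!: continuous_intros\<close>)
  then show ?thesis
    unfolding phi_def by (intro continuous_intros)
qed

section \<open>Integration of the interpolant\<close>

text \<open>On each gap \<open>F\<close> is given by its endpoint values, so the gap contributes one
  term per endpoint and two correction terms. Collecting the endpoint terms by design point joins
  the two gaps meeting at an inner point, and joins the outermost gaps with the tails.\<close>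

lemma integral_exp_kernel_interpolant:
  fixes c t :: "nat \<Rightarrow> real" and \<phi> :: "real \<Rightarrow> real"
  assumes \<phi>: "continuous_on UNIV \<phi>"
    and n: "2 \<le> n" and "0 \<le> t 1" and mono: "strict_mono_on {1..n} t" and "t n \<le> 1"
  defines "F \<equiv> \<lambda>s. \<Sum>j=1..n. c j * exp (- \<bar>t j - s\<bar>)"
  shows "integral {0..1} (\<lambda>s. F s * \<phi> s) =
      (\<Sum>i=2..n-1. F (t i) * integral {t (i-1)..t (i+1)} (\<lambda>s. exp \<bar>s - t i\<bar> * \<phi> s))
    + F (t 1) * integral {0..t 2} (\<lambda>s. exp (s - t 1) * \<phi> s)
    + F (t n) * integral {t (n-1)..1} (\<lambda>s. exp (t n - s) * \<phi> s)
    - (\<Sum>i=1..n-1.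
          (exp (t (i+1)) * F (t (i+1)) - exp (t i) * F (t i))
            / (1 - exp (- 2 * (t (i+1) - t i)))
          * integral {t i..t (i+1)} (\<lambda>s. exp (- s) * \<phi> s))
    + (\<Sum>i=1..n-1.
          (exp (- t (i+1)) * F (t (i+1)) - exp (- t i) * F (t i))
            / (1 - exp (- 2 * (t (i+1) - t i)))
          * integral {t i..t (i+1)} (\<lambda>s. exp s * \<phi> s))"
proof -
  have cont: "continuous_on A \<phi>" for A using \<phi> continuous_on_subset by blast
  have int: "(\<lambda>s. w s * \<phi> s) integrable_on {a..b}" if "continuous_on {a..b} w" for w a b
    using that cont by (intro integrable_continuous_real continuous_intros)
  have le: "t i \<le> t j" if "i \<in> {1..n}" "j \<in> {1..n}" "i \<le> j" for i j
    using strict_mono_on_leD[OF mono] that by blast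
  have lt: "t i < t (i+1)" if "i \<in> {1..n-1}" for i
    using strict_mono_onD[OF mono, of i "i+1"] that n by auto
  \<comment> \<open>To the left of the design, the distance from \<open>s\<close> to
    \<open>t j\<close> is the sum of those from \<open>s\<close> to \<open>t 1\<close> and from
    \<open>t 1\<close> to \<open>t j\<close>. The right tail is symmetric.\<close>
  have F_left: "F s = F (t 1) * exp (s - t 1)" if "s \<le> t 1" for s
    unfolding F_def sum_distrib_right
  proof (rule sum.cong)
    fix j assume "j \<in> {1..n}"
    then have "t 1 \<le> t j" using le n by simp
    then show "c j * exp (- \<bar>t j - s\<bar>) = c j * exp (- \<bar>t j - t 1\<bar>) * exp (s - t 1)"
      using that by (simp add: mult_exp_exp)
  qed simp
  have F_right: "F s = F (t n) * exp (t n - s)" if "t n \<le> s" for s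
    unfolding F_def sum_distrib_right
  proof (rule sum.cong)
    fix j assume "j \<in> {1..n}"
    then have "t j \<le> t n" using le n by simp
    then show "c j * exp (- \<bar>t j - s\<bar>) = c j * exp (- \<bar>t j - t n\<bar>) * exp (t n - s)"
      using that by (simp add: mult_exp_exp)
  qed simp
  define P where "P i = (exp (t (i+1)) * F (t (i+1)) - exp (t i) * F (t i))
    / (1 - exp (- 2 * (t (i+1) - t i)))" for i
  define Q where "Q i = (exp (- t (i+1)) * F (t (i+1)) - exp (- t i) * F (t i))
    / (1 - exp (- 2 * (t (i+1) - t i)))" for i
  have F_mid: "F s = F (t i) * exp (s - t i) + F (t (i+1)) * exp (t (i+1) - s)
      - P i * exp (- s) + Q i * exp s"
    if i: "i \<in> {1..n-1}" and s: "t i \<le> s" "s \<le> t (i+1)" for s i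
  proof -
    let ?D = "1 - exp (- 2 * (t (i+1) - t i))"
    let ?e = "\<lambda>u j. exp (- \<bar>t j - u\<bar>)"
    \<comment> \<open>No design point lies strictly between \<open>t i\<close> and
      \<open>t (i+1)\<close>, so the interpolation formula applies to every summand of
      \<open>F\<close>.\<close>
    have term_eq: "c j * ?e s j =
        exp (s - t i) * (c j * ?e (t i) j) + exp (t (i+1) - s) * (c j * ?e (t (i+1)) j)
        - exp (- s) / ?D * (exp (t (i+1)) * (c j * ?e (t (i+1)) j) - exp (t i) * (c j * ?e (t i) j))
        + exp s / ?D * (exp (- t (i+1)) * (c j * ?e (t (i+1)) j) - exp (- t i) * (c j * ?e (t i) j))"
      if j: "j \<in> {1..n}" for j
    proof -
      have "t j \<le> t i \<or> t (i+1) \<le> t j"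
        using le[of j i] le[of "i+1" j] i j by (cases "j \<le> i") auto
      then show ?thesis
        by (subst exp_kernel_interpolation[OF lt[OF i] s])
          (simp_all only: diff_divide_distrib algebra_simps times_divide_eq_left times_divide_eq_right)
    qed
    have "F s = exp (s - t i) * F (t i) + exp (t (i+1) - s) * F (t (i+1))
        - exp (- s) / ?D * (exp (t (i+1)) * F (t (i+1)) - exp (t i) * F (t i))
        + exp s / ?D * (exp (- t (i+1)) * F (t (i+1)) - exp (- t i) * F (t i))"
      unfolding F_def sum_distrib_left sum.distrib[symmetric] sum_subtractf[symmetric]
      by (rule sum.cong[OF refl]) (use term_eq in \<open>simp add: sum_distrib_left\<close>)
    then show ?thesis by (simp add: P_def Q_def mult_ac)
  qed
  \<comment> \<open>On gap \<open>i\<close>, \<open>A i\<close> and \<open>B i\<close> belong to its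
    left and right endpoint and \<open>C i\<close>, \<open>E i\<close> to the corrections;
    \<open>L\<close> and \<open>U\<close> are the tails.\<close>
  define A where "A i = integral {t i..t (i+1)} (\<lambda>s. exp (s - t i) * \<phi> s)" for i
  define B where "B i = integral {t i..t (i+1)} (\<lambda>s. exp (t (i+1) - s) * \<phi> s)" for i
  define C where "C i = integral {t i..t (i+1)} (\<lambda>s. exp (- s) * \<phi> s)" for i
  define E where "E i = integral {t i..t (i+1)} (\<lambda>s. exp s * \<phi> s)" for i
  define L where "L = integral {0..t 1} (\<lambda>s. exp (s - t 1) * \<phi> s)"
  define U where "U = integral {t n..1} (\<lambda>s. exp (t n - s) * \<phi> s)"
  have combine: "integral {a..b} (\<lambda>s. w s * \<phi> s) =
      integral {a..p} (\<lambda>s. w s * \<phi> s) + integral {p..b} (\<lambda>s. w s * \<phi> s)"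
    if "a \<le> p" "p \<le> b" "continuous_on {a..b} w" for a b p w
    using Henstock_Kurzweil_Integration.integral_combine[OF that(1,2) int[OF that(3)]] by simp
  have contF: "continuous_on X F" for X
    unfolding F_def by (intro continuous_intros)
  have left: "integral {0..t 1} (\<lambda>s. F s * \<phi> s) = F (t 1) * L"
    unfolding L_def integral_mult_right[symmetric]
    by (intro Henstock_Kurzweil_Integration.integral_cong) (subst F_left, simp_all)
  have right: "integral {t n..1} (\<lambda>s. F s * \<phi> s) = F (t n) * U"
    unfolding U_def integral_mult_right[symmetric]
    by (intro Henstock_Kurzweil_Integration.integral_cong) (subst F_right, simp_all)
  have mid: "integral {t i..t (i+1)} (\<lambda>s. F s * \<phi> s) =
      F (t i) * A i + F (t (i+1)) * B i - P i * C i + Q i * E i" if i: "i \<in> {1..n-1}" for i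
  proof -
    have "integral {t i..t (i+1)} (\<lambda>s. F s * \<phi> s) = integral {t i..t (i+1)}
        (\<lambda>s. F (t i) * (exp (s - t i) * \<phi> s) + F (t (i+1)) * (exp (t (i+1) - s) * \<phi> s)
          - P i * (exp (- s) * \<phi> s) + Q i * (exp s * \<phi> s))"
    proof (rule Henstock_Kurzweil_Integration.integral_cong)
      fix s assume "s \<in> {t i..t (i+1)}"
      then have Fs: "F s = F (t i) * exp (s - t i) + F (t (i+1)) * exp (t (i+1) - s)
          - P i * exp (- s) + Q i * exp s"
        by (intro F_mid[OF i]) simp_all
      show "F s * \<phi> s = F (t i) * (exp (s - t i) * \<phi> s) + F (t (i+1)) * (exp (t (i+1) - s) * \<phi> s)
          - P i * (exp (- s) * \<phi> s) + Q i * (exp s * \<phi> s)"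
        unfolding Fs by (simp only: algebra_simps)
    qed
    also have "\<dots> = F (t i) * A i + F (t (i+1)) * B i - P i * C i + Q i * E i"
      unfolding A_def B_def C_def E_def
      by (intro integral_unique has_integral_add has_integral_diff has_integral_mult_right
          integrable_integral int continuous_intros)
    finally show ?thesis .
  qed
  have "integral {0..1} (\<lambda>s. F s * \<phi> s) = integral {0..t 1} (\<lambda>s. F s * \<phi> s)
      + integral {t 1..t n} (\<lambda>s. F s * \<phi> s) + integral {t n..1} (\<lambda>s. F s * \<phi> s)"
    using combine[of 0 "t 1" 1 F] combine[of "t 1" "t n" 1 F] le[of 1 n] assms(3,5) n contF by simp
  also have "\<dots> = F (t 1) * L + F (t n) * U
      + (\<Sum>i=1..n-1. F (t i) * A i + F (t (i+1)) * B i - P i * C i + Q i * E i)"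
  proof -
    have "integral {t 1..t n} (\<lambda>s. F s * \<phi> s)
        = (\<Sum>i=1..n-1. integral {t i..t (i+1)} (\<lambda>s. F s * \<phi> s))"
      using mono n by (intro integral_consecutive continuous_intros contF cont) auto
    then show ?thesis using left right mid by simp
  qed
  finally have lhs: "integral {0..1} (\<lambda>s. F s * \<phi> s) = F (t 1) * L + F (t n) * U
      + (\<Sum>i=1..n-1. F (t i) * A i) + (\<Sum>i=1..n-1. F (t (i+1)) * B i)
      - (\<Sum>i=1..n-1. P i * C i) + (\<Sum>i=1..n-1. Q i * E i)"
    by (simp add: sum.distrib sum_subtractf)
  \<comment> \<open>The absolute value is \<open>t i - s\<close> on the gap before
    \<open>t i\<close> and \<open>s - t i\<close> on the gap after it. The bound
    \<open>2 \<le> i\<close> makes \<open>i - 1\<close> a genuine predecessor.\<close>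
  have inner: "integral {t (i-1)..t (i+1)} (\<lambda>s. exp \<bar>s - t i\<bar> * \<phi> s) = B (i-1) + A i"
    if i: "i \<in> {2..n-1}" for i
  proof -
    have "t (i-1) \<le> t i" "t i \<le> t (i+1)" using i le by auto
    then have "integral {t (i-1)..t (i+1)} (\<lambda>s. exp \<bar>s - t i\<bar> * \<phi> s) =
        integral {t (i-1)..t i} (\<lambda>s. exp \<bar>s - t i\<bar> * \<phi> s)
        + integral {t i..t (i+1)} (\<lambda>s. exp \<bar>s - t i\<bar> * \<phi> s)"
      by (intro combine continuous_intros)
    moreover have "i - 1 + 1 = i" using i by simp
    then have "integral {t (i-1)..t i} (\<lambda>s. exp \<bar>s - t i\<bar> * \<phi> s) = B (i-1)"
      unfolding B_def by (simp only:) (intro Henstock_Kurzweil_Integration.integral_cong, auto)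
    moreover have "integral {t i..t (i+1)} (\<lambda>s. exp \<bar>s - t i\<bar> * \<phi> s) = A i"
      unfolding A_def by (intro Henstock_Kurzweil_Integration.integral_cong) auto
    ultimately show ?thesis by simp
  qed
  \<comment> \<open>The weight of the left tail and that of \<open>t 1\<close> on the first gap are
    the same function, so the two integrals merge without a change of sign; likewise at
    \<open>t n\<close>.\<close>
  have first: "integral {0..t 2} (\<lambda>s. exp (s - t 1) * \<phi> s) = L + A 1"
    using combine[of 0 "t 1" "t 2" "\<lambda>s. exp (s - t 1)"] assms(3) le[of 1 2] n
    by (simp add: L_def A_def continuous_intros numeral_2_eq_2)
  have last: "integral {t (n-1)..1} (\<lambda>s. exp (t n - s) * \<phi> s) = B (n-1) + U"
    using combine[of "t (n-1)" "t n" 1 "\<lambda>s. exp (t n - s)"] assms(5) le[of "n-1" n] n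
    by (simp add: U_def B_def continuous_intros)
  have sumA: "(\<Sum>i=1..n-1. F (t i) * A i) = F (t 1) * A 1 + (\<Sum>i=2..n-1. F (t i) * A i)"
    using n by (subst sum.atLeast_Suc_atMost) (auto simp: numeral_2_eq_2)
  \<comment> \<open>Right endpoints are renumbered by their own index, with \<open>t n\<close> split
    off. For \<open>n = 2\<close> the inner sum is empty.\<close>
  have sumB: "(\<Sum>i=1..n-1. F (t (i+1)) * B i)
      = (\<Sum>i=2..n-1. F (t i) * B (i-1)) + F (t n) * B (n-1)"
  proof -
    obtain k where k: "n = Suc (Suc k)" using n by (metis add_2_eq_Suc le_Suc_ex)
    have "(\<Sum>i=1..n-1. F (t (i+1)) * B i) = (\<Sum>i=1..k. F (t (i+1)) * B i) + F (t n) * B (n-1)"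
      by (simp add: k)
    also have "(\<Sum>i=1..k. F (t (i+1)) * B i) = (\<Sum>i=2..n-1. F (t i) * B (i-1))"
      using sum.shift_bounds_cl_Suc_ivl[of "\<lambda>i. F (t i) * B (i-1)" 1 k]
      by (simp add: k numeral_2_eq_2)
    finally show ?thesis .
  qed
  have "(\<Sum>i=2..n-1. F (t i) * integral {t (i-1)..t (i+1)} (\<lambda>s. exp \<bar>s - t i\<bar> * \<phi> s))
      = (\<Sum>i=2..n-1. F (t i) * B (i-1)) + (\<Sum>i=2..n-1. F (t i) * A i)"
    unfolding sum.distrib[symmetric] by (intro sum.cong refl) (simp only: inner distrib_left)
  then show ?thesis
    unfolding lhs sumA sumB first last P_def Q_def C_def E_def
    by (simp only: algebra_simps)
qed

section \<open>The projection estimator under Ornstein-Uhlenbeck errors\<close>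

theorem proposition2:
  fixes M :: "'w measure"
    and g K :: "real \<Rightarrow> real"
    and \<epsilon> :: "real \<Rightarrow> 'w \<Rightarrow> real"
    and \<epsilon>s Y :: "nat \<Rightarrow> real \<Rightarrow> 'w \<Rightarrow> real"
    and t :: "nat \<Rightarrow> real"
    and n m :: nat
    and h x :: real
    and \<omega> :: 'w
  assumes "prob_space M"
    and "ornstein_uhlenbeck_process M {0..1} \<epsilon>"
    and "iid_copies M {0..1} \<epsilon> {1..m} \<epsilon>s"
    and "n \<ge> 2" and "m \<ge> 1"
    and "0 \<le> t 1" and "strict_mono_on {1..n} t" and "t n \<le> 1"
    and "\<And>i j \<omega>. i \<in> {1..n} \<Longrightarrow> j \<in> {1..m} \<Longrightarrow> \<omega> \<in> space M \<Longrightarrow>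
           Y j (t i) \<omega> = g (t i) + \<epsilon>s j (t i) \<omega>"
    and "smoothing_kernel K"
    and "0 < h" and "h < 1"
    and "x \<in> {0..1}"
    and "\<omega> \<in> space M"
  shows "g_pro (autocov M \<epsilon>) K h n t m Y x \<omega> =
      (\<Sum>i=2..n-1. Ybar m Y (t i) \<omega> *
          integral {t (i-1)..t (i+1)} (\<lambda>s. exp \<bar>s - t i\<bar> * phi K x h s))
    + Ybar m Y (t 1) \<omega> * integral {0..t 2} (\<lambda>s. exp (s - t 1) * phi K x h s)
    + Ybar m Y (t n) \<omega> * integral {t (n-1)..1} (\<lambda>s. exp (t n - s) * phi K x h s)
    - (\<Sum>i=1..n-1.
          (exp (t (i+1)) * Ybar m Y (t (i+1)) \<omega> - exp (t i) * Ybar m Y (t i) \<omega>)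
            / (1 - exp (- 2 * (t (i+1) - t i)))
          * integral {t i..t (i+1)} (\<lambda>s. exp (- s) * phi K x h s))
    + (\<Sum>i=1..n-1.
          (exp (- t (i+1)) * Ybar m Y (t (i+1)) \<omega> - exp (- t i) * Ybar m Y (t i) \<omega>)
            / (1 - exp (- 2 * (t (i+1) - t i)))
          * integral {t i..t (i+1)} (\<lambda>s. exp s * phi K x h s))"
proof -
  define R where "R = (\<lambda>s u :: real. exp (- \<bar>u - s\<bar>))"
  define F where "F c s = (\<Sum>j=1..n. c j * exp (- \<bar>t j - s\<bar>))" for c s
  have t01: "t i \<in> {0..1}" if "i \<in> {1..n}" for i
    using strict_mono_on_leD[OF assms(7), of 1 i] strict_mono_on_leD[OF assms(7), of i n]
      that assms(6,8) by auto
  have "autocov M \<epsilon> s u = R s u" if "s \<in> {0..1}" "u \<in> {0..1}" for s u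
    using assms(2) that by (auto simp: ornstein_uhlenbeck_process_def R_def)
  then have "proj_weights (autocov M \<epsilon>) K x h n t = proj_weights R K x h n t"
    using t01 by (intro proj_weights_cong)
  then have g: "g_pro (autocov M \<epsilon>) K h n t m Y x \<omega> = g_pro R K h n t m Y x \<omega>"
    by (simp add: g_pro_def)
  obtain c where c: "\<And>k. k \<in> {1..n} \<Longrightarrow> (\<Sum>j=1..n. c j * R (t k) (t j)) = Ybar m Y (t k) \<omega>"
    "g_pro R K h n t m Y x \<omega> = (\<Sum>j=1..n. c j * f_proj R K x h (t j))"
    using g_pro_eq_sum_coeffs[of R n t m Y \<omega> K h x] det_cov_mat_exp_nonzero[OF assms(7)]
    unfolding R_def by blast
  \<comment> \<open>Row \<open>k\<close> of the covariance system says that \<open>F c\<close>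
    interpolates the averaged data at \<open>t k\<close>.\<close>
  have F: "Ybar m Y (t k) \<omega> = F c (t k)" if "k \<in> {1..n}" for k
    using c(1)[OF that] by (simp add: F_def R_def)
  have cont: "continuous_on A (phi K x h)" for A
    using assms(10,11) by (intro continuous_on_phi) auto
  have "(\<Sum>j=1..n. c j * f_proj R K x h (t j))
      = integral {0..1} (\<lambda>s. \<Sum>j=1..n. c j * (R s (t j) * phi K x h s))"
    unfolding f_proj_def R_def
    by (subst integral_sum)
      (auto intro!: integrable_continuous_real continuous_intros cont)
  also have "\<dots> = integral {0..1} (\<lambda>s. F c s * phi K x h s)"
    unfolding F_def R_def sum_distrib_right mult.assoc ..
  finally have "g_pro (autocov M \<epsilon>) K h n t m Y x \<omega> = integral {0..1} (\<lambda>s. F c s * phi K x h s)"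
    using g c(2) by simp
  note main = this[unfolded F_def integral_exp_kernel_interpolant[OF cont assms(4,6,7,8)],
      folded F_def]
  \<comment> \<open>Interpolation holds only at indices in \<open>{1..n}\<close>, so averages are
    exchanged for values of \<open>F c\<close> under the sums, where the index ranges are
    known.\<close>
  have inner: "(\<Sum>i=2..n-1. Ybar m Y (t i) \<omega> * I i) = (\<Sum>i=2..n-1. F c (t i) * I i)" for I
    by (intro sum.cong) (auto simp: F)
  \<comment> \<open>The factor \<open>a\<close> is kept general to serve both correction sums, with
    \<open>exp (t i)\<close> and \<open>exp (- t i)\<close>.\<close>
  have slopes: "(\<Sum>i=1..n-1. (a (i+1) * Ybar m Y (t (i+1)) \<omega> - a i * Ybar m Y (t i) \<omega>) / d i * I i)
      = (\<Sum>i=1..n-1. (a (i+1) * F c (t (i+1)) - a i * F c (t i)) / d i * I i)" for a d I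
    by (intro sum.cong) (auto simp: F)
  have ends: "Ybar m Y (t 1) \<omega> = F c (t 1)" "Ybar m Y (t n) \<omega> = F c (t n)"
    using assms(4) by (auto simp: F)
  show ?thesis
    unfolding main inner ends slopes[of "\<lambda>i. exp (t i)"] slopes[of "\<lambda>i. exp (- t i)"] ..
qed

end
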